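(* Let $N\ge 1$, let $X$ be a random variable on $[N]=\{1,\dots,N\}$ with probability mass function $p$ satisfying $p(1)\ge p(2)\ge\cdots\ge p(N)$, let $\epsilon\in[0,1]$, and let $f:[N]\to\mathbb{R}$ be nondecreasing. Let $A_{\mathrm{ZZ}}=\{k\in[N]: k\text{ odd}\}$. Then $$G^f_{A_{\mathrm{ZZ}}}(X)=\min_{A\subseteq[N]} G^f_A(X).$$
   Context: For $A\subseteq[N]$, let $Y_A=\mathbb{1}(X\in A)\oplus V$, where $V\sim\mathrm{Bernoulli}(\epsilon)$ is independent of $X$ and $\oplus$ is addition modulo 2. A guessing strategy given $Y_A$ assigns to each $y\in\{0,1\}$ an ordering (permutation) of $[N]$; the guessing time $T$ is the position of $X$ in the ordering assigned to the observed value $Y_A$. $G^f_A(X)$ denotes the minimum of $\mathbb{E}[f(T)]$ over all guessing strategies given $Y_A$. *)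

theory Defs
  imports "HOL-Probability.Probability"
begin

text \<open>
  Independence of two random variables is independence of the \<open>\<sigma>\<close>-algebras they generate.
  \<^const>\<open>prob_space.indep_var\<close> says the same, but only for variables with a common value type.
\<close>

definition independent_rvs ::
  "'a measure \<Rightarrow> 'b measure \<Rightarrow> ('a \<Rightarrow> 'b) \<Rightarrow> 'c measure \<Rightarrow> ('a \<Rightarrow> 'c) \<Rightarrow> bool" where
  "independent_rvs M S X T Y \<longleftrightarrow>
     X \<in> measurable M S \<and> Y \<in> measurable M T \<and>
     prob_space.indep_set M
       (sets (vimage_algebra (space M) X S)) (sets (vimage_algebra (space M) Y T))"

lemma independent_rvs_iff_indep_var:
  assumes "prob_space M"
  shows "independent_rvs M S X T Y \<longleftrightarrow> prob_space.indep_var M S X T Y"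
proof -
  interpret prob_space M by fact
  have "sigma_sets (space M) {Z -` A \<inter> space M |A. A \<in> sets R} = sets (vimage_algebra (space M) Z R)"
    for Z :: "'a \<Rightarrow> 'b" and R
    by (simp add: sets_vimage_algebra)
  then show ?thesis
    unfolding independent_rvs_def indep_var_eq by auto
qed

text \<open>
  The bits 0 and 1 are represented by \<^term>\<open>False\<close> and \<^term>\<open>True\<close>, so that addition modulo 2 is
  exclusive or, i.e. disequality of truth values.
\<close>

definition noisy_answer ::
  "('a \<Rightarrow> nat) \<Rightarrow> ('a \<Rightarrow> bool) \<Rightarrow> nat set \<Rightarrow> 'a \<Rightarrow> bool" where
  "noisy_answer X V A \<omega> \<longleftrightarrow> (X \<omega> \<in> A) \<noteq> V \<omega>"

text \<open>
  \<^term>\<open>\<sigma> y i\<close> is the \<^term>\<open>i\<close>-th guess after observing \<^term>\<open>y\<close>. A function that permutes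
  \<^term>\<open>{1..N}\<close> is the identity elsewhere, so there are only finitely many strategies.
\<close>

definition guessing_strategies :: "nat \<Rightarrow> (bool \<Rightarrow> nat \<Rightarrow> nat) set" where
  "guessing_strategies N = {\<sigma>. \<forall>y. \<sigma> y permutes {1..N}}"

definition guessing_time ::
  "(bool \<Rightarrow> nat \<Rightarrow> nat) \<Rightarrow> ('a \<Rightarrow> nat) \<Rightarrow> ('a \<Rightarrow> bool) \<Rightarrow> 'a \<Rightarrow> nat" where
  "guessing_time \<sigma> X Y \<omega> = inv (\<sigma> (Y \<omega>)) (X \<omega>)"

definition min_guessing_cost ::
  "'a measure \<Rightarrow> nat \<Rightarrow> (nat \<Rightarrow> real) \<Rightarrow> ('a \<Rightarrow> nat) \<Rightarrow> ('a \<Rightarrow> bool) \<Rightarrow> nat set \<Rightarrow> real" where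
  "min_guessing_cost M N f X V A =
     Min ((\<lambda>\<sigma>. \<integral>\<omega>. f (guessing_time \<sigma> X (noisy_answer X V A) \<omega>) \<partial>M) ` guessing_strategies N)"

lemma finite_guessing_strategies: "finite (guessing_strategies N)"
proof -
  have "guessing_strategies N = PiE UNIV (\<lambda>_. {\<pi>. \<pi> permutes {1..N}})"
    by (auto simp: guessing_strategies_def)
  then show ?thesis
    by (simp add: finite_PiE finite_permutations)
qed

lemma guessing_strategies_nonempty: "guessing_strategies N \<noteq> {}"
proof -
  have "(\<lambda>_. id) \<in> guessing_strategies N"
    by (simp add: guessing_strategies_def permutes_id)
  then show ?thesis
    by blast
qed

definition zigzag_set :: "nat \<Rightarrow> nat set" where
  "zigzag_set N = {k \<in> {1..N}. odd k}"

end

theory Submission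
  imports Defs
begin

text \<open>
  Whatever \<open>A\<close> is, a strategy spreads the same \<open>2 N\<close> atoms \<open>(X, V) = (k, v)\<close> over two lists, and
  every guessing time is used by exactly two atoms. So the cost is at least that of handing out
  the times \<open>1, 1, 2, 2, \<dots>\<close> to the atoms in the order of decreasing probability.
  That order merges the two decreasing sequences \<open>(1 - \<epsilon>) p\<close> and \<open>\<epsilon> p\<close>. For the zigzag set the
  atoms at positions \<open>2 j - 1\<close> and \<open>2 j\<close> of the merged order always lie in different lists,
  by parity, so the bound is attained.
\<close>

section \<open>Rearrangement of times against weights\<close>

text \<open>Layer decomposition: for nondecreasing \<open>f\<close> the coefficients of the
  threshold functions are nonnegative, so costs can be compared one threshold \<open>j\<close> at a
  time.\<close>

lemma telescope_indicator:
  fixes f :: "nat \<Rightarrow> real"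
  assumes "t \<in> {1..N}"
  shows "f t = f 1 + (\<Sum>j\<in>{1..<N}. (f (Suc j) - f j) * of_bool (j < t))"
proof -
  have "(\<Sum>j\<in>{1..<N}. (f (Suc j) - f j) * of_bool (j < t)) = (\<Sum>j\<in>{1..<t}. f (Suc j) - f j)"
    using assms by (intro sum.mono_neutral_cong_right) auto
  also have "\<dots> = f t - f 1"
    using assms by (intro sum_Suc_diff') auto
  finally show ?thesis
    by simp
qed

text \<open>Some constant \<open>c\<close> separates the weights: indices that \<open>S\<close>
  places above \<open>j\<close> weigh at most \<open>c\<close>, all others at least
  \<open>c\<close>. Hence no other set of the same size is lighter.\<close>

lemma sum_upper_level_le:
  fixes W :: "'i \<Rightarrow> real" and S T :: "'i \<Rightarrow> nat"
  assumes "finite I"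
    and sorted: "\<And>x y. x \<in> I \<Longrightarrow> y \<in> I \<Longrightarrow> W x < W y \<Longrightarrow> S y \<le> S x"
    and count: "(\<Sum>x\<in>I. of_bool (j < S x)) = (\<Sum>x\<in>I. of_bool (j < T x) :: real)"
  shows "(\<Sum>x\<in>I. W x * of_bool (j < S x)) \<le> (\<Sum>x\<in>I. W x * of_bool (j < T x))"
proof -
  obtain c where low: "\<And>x. x \<in> I \<Longrightarrow> j < S x \<Longrightarrow> W x \<le> c"
    and high: "\<And>x. x \<in> I \<Longrightarrow> \<not> j < S x \<Longrightarrow> c \<le> W x"
  proof (cases "\<exists>x\<in>I. j < S x")
    case True
    let ?B = "W ` {x \<in> I. j < S x}"
    have fin: "finite ?B" and ne: "?B \<noteq> {}"
      using \<open>finite I\<close> True by auto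
    have "Max ?B \<le> W x" if "x \<in> I" "\<not> j < S x" for x
    proof (rule Max.boundedI[OF fin ne])
      show "w \<le> W x" if "w \<in> ?B" for w
        using that sorted[OF \<open>x \<in> I\<close>] \<open>\<not> j < S x\<close> by (force simp: not_le[symmetric])
    qed
    moreover have "W x \<le> Max ?B" if "x \<in> I" "j < S x" for x
      using fin that by (intro Max_ge) auto
    ultimately show ?thesis
      using that by blast
  next
    case False
    \<comment> \<open>With nothing above \<open>j\<close>, only \<open>high\<close> restricts
      \<open>c\<close>. If \<open>I\<close> is empty, that is vacuous too, and the unspecified value
      of \<open>Min {}\<close> does no harm.\<close>
    then show ?thesis
      using that[of "Min (W ` I)"] \<open>finite I\<close> by auto
  qed
  \<comment> \<open>The two factors never have opposite signs. After expansion the terms in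
    \<open>c\<close> cancel because both levels have the same size.\<close>
  have "0 \<le> (\<Sum>x\<in>I. (W x - c) * (of_bool (j < T x) - of_bool (j < S x)))"
    using low high by (intro sum_nonneg) (auto simp: of_bool_def)
  also have "\<dots> = (\<Sum>x\<in>I. W x * of_bool (j < T x)) - (\<Sum>x\<in>I. W x * of_bool (j < S x))
      - c * ((\<Sum>x\<in>I. of_bool (j < T x)) - (\<Sum>x\<in>I. of_bool (j < S x)))"
    by (simp add: algebra_simps sum.distrib sum_subtractf sum_distrib_left)
  finally show ?thesis
    using count by simp
qed

text \<open>Both sums are split into layers, and each layer is an instance of
  \<open>sum_upper_level_le\<close>. Over all \<open>j\<close>, \<open>count\<close> says that
  \<open>S\<close> and \<open>T\<close> take every value equally often.\<close>

lemma rearrangement_le: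
  fixes W :: "'i \<Rightarrow> real" and S T :: "'i \<Rightarrow> nat" and f :: "nat \<Rightarrow> real"
  assumes "finite I" and S: "S \<in> I \<rightarrow> {1..N}" and T: "T \<in> I \<rightarrow> {1..N}"
    and f: "mono_on {1..N} f"
    and sorted: "\<And>x y. x \<in> I \<Longrightarrow> y \<in> I \<Longrightarrow> W x < W y \<Longrightarrow> S y \<le> S x"
    and count: "\<And>j. (\<Sum>x\<in>I. of_bool (j < S x)) = (\<Sum>x\<in>I. of_bool (j < T x) :: real)"
  shows "(\<Sum>x\<in>I. W x * f (S x)) \<le> (\<Sum>x\<in>I. W x * f (T x))"
proof -
  have expand: "(\<Sum>x\<in>I. W x * f (R x)) =
      f 1 * (\<Sum>x\<in>I. W x) + (\<Sum>j\<in>{1..<N}. (f (Suc j) - f j) * (\<Sum>x\<in>I. W x * of_bool (j < R x)))"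
    if "R \<in> I \<rightarrow> {1..N}" for R
  proof -
    have "(\<Sum>x\<in>I. W x * f (R x)) =
        (\<Sum>x\<in>I. f 1 * W x + (\<Sum>j\<in>{1..<N}. (f (Suc j) - f j) * (W x * of_bool (j < R x))))"
    proof (intro sum.cong refl)
      fix x assume "x \<in> I"
      then have "R x \<in> {1..N}"
        using that by auto
      from telescope_indicator[OF this, of f]
      have "W x * f (R x) = W x * (f 1 + (\<Sum>j\<in>{1..<N}. (f (Suc j) - f j) * of_bool (j < R x)))"
        by (rule arg_cong)
      then show "W x * f (R x) =
          f 1 * W x + (\<Sum>j\<in>{1..<N}. (f (Suc j) - f j) * (W x * of_bool (j < R x)))"
        by (simp only: distrib_left sum_distrib_left mult_ac)
    qed
    also have "\<dots> = f 1 * (\<Sum>x\<in>I. W x)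
        + (\<Sum>x\<in>I. \<Sum>j\<in>{1..<N}. (f (Suc j) - f j) * (W x * of_bool (j < R x)))"
      by (simp only: sum.distrib sum_distrib_left)
    also have "(\<Sum>x\<in>I. \<Sum>j\<in>{1..<N}. (f (Suc j) - f j) * (W x * of_bool (j < R x)))
        = (\<Sum>j\<in>{1..<N}. (f (Suc j) - f j) * (\<Sum>x\<in>I. W x * of_bool (j < R x)))"
      by (subst sum.swap) (simp only: sum_distrib_left)
    finally show ?thesis .
  qed
  have "(f (Suc j) - f j) * (\<Sum>x\<in>I. W x * of_bool (j < S x))
      \<le> (f (Suc j) - f j) * (\<Sum>x\<in>I. W x * of_bool (j < T x))" if "j \<in> {1..<N}" for j
  proof (rule mult_left_mono)
    show "(\<Sum>x\<in>I. W x * of_bool (j < S x)) \<le> (\<Sum>x\<in>I. W x * of_bool (j < T x))"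
      using \<open>finite I\<close> sorted count by (rule sum_upper_level_le)
    show "0 \<le> f (Suc j) - f j"
      using mono_onD[OF f, of j "Suc j"] that by simp
  qed
  then show ?thesis
    unfolding expand[OF S] expand[OF T] by (intro add_left_mono sum_mono)
qed

section \<open>Ranks in the merged order and the times they induce\<close>

text \<open>Here \<open>u v k\<close> is the weight of the atom \<open>(k, v)\<close>. For
  decreasing sequences this is the position in the merged order: \<open>k\<close> counts the own
  sequence, the cardinality the other one. Ties between the sequences put \<open>False\<close>
  first, which keeps the ranks distinct.\<close>

definition merge_rank :: "nat \<Rightarrow> (bool \<Rightarrow> nat \<Rightarrow> real) \<Rightarrow> bool \<Rightarrow> nat \<Rightarrow> nat" where
  "merge_rank N u v k =
     k + card {i \<in> {1..N}. u v k < u (\<not> v) i \<or> (v \<and> u v k = u (\<not> v) i)}"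

text \<open>Half the rank, rounded up: ranks \<open>2 j - 1\<close> and \<open>2 j\<close> share the
  time \<open>j\<close>.\<close>

definition zigzag_time :: "nat \<Rightarrow> (bool \<Rightarrow> nat \<Rightarrow> real) \<Rightarrow> bool \<Rightarrow> nat \<Rightarrow> nat" where
  "zigzag_time N u v k = (merge_rank N u v k + 1) div 2"

lemma card_prefix_le:
  assumes "\<And>i. i \<in> {1..N} \<Longrightarrow> P i \<Longrightarrow> i < (n::nat)" and "1 \<le> n"
  shows "card {i \<in> {1..N}. P i} \<le> n - 1"
proof -
  have "{i \<in> {1..N}. P i} \<subseteq> {1..<n}"
    using assms(1) by auto
  from card_mono[OF _ this] show ?thesis
    by simp
qed

lemma card_prefix_ge:
  assumes "\<And>i. 1 \<le> i \<Longrightarrow> i \<le> n \<Longrightarrow> P i" and "n \<le> (N::nat)"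
  shows "n \<le> card {i \<in> {1..N}. P i}"
proof -
  have "{1..n} \<subseteq> {i \<in> {1..N}. P i}"
    using assms by auto
  from card_mono[OF _ this] show ?thesis
    by simp
qed

text \<open>The own index contributes \<open>i - k\<close>, and the count in the other sequence
  cannot shrink as the weight falls. The gap is recorded because indices of equal parity must end up
  two ranks apart.\<close>

lemma merge_rank_strict_mono:
  assumes "antimono_on {1..N} (u v)" "k \<in> {1..N}" "i \<in> {1..N}" "k < i"
  shows "merge_rank N u v k + (i - k) \<le> merge_rank N u v i"
proof -
  have "u v i \<le> u v k"
    using monotone_onD[OF assms(1)] assms(2-4) by simp
  then have "card {j \<in> {1..N}. u v k < u (\<not> v) j \<or> (v \<and> u v k = u (\<not> v) j)}
      \<le> card {j \<in> {1..N}. u v i < u (\<not> v) j \<or> (v \<and> u v i = u (\<not> v) j)}"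
    by (intro card_mono) auto
  then show ?thesis
    using \<open>k < i\<close> by (simp add: merge_rank_def)
qed

text \<open>The index sum separates the ranks of two atoms taken from different sequences.\<close>

lemma merge_rank_cross:
  assumes mono: "\<And>v. antimono_on {1..N} (u v)" and k: "k \<in> {1..N}" and i: "i \<in> {1..N}"
  shows "u True i \<le> u False k \<Longrightarrow> merge_rank N u False k < k + i \<and> k + i \<le> merge_rank N u True i"
    and "u False k < u True i \<Longrightarrow> merge_rank N u True i < k + i \<and> k + i \<le> merge_rank N u False k"
proof -
  have anti: "u v b \<le> u v a" if "1 \<le> a" "a \<le> b" "b \<le> N" for v a b
    using monotone_onD[OF mono] that by simp
  {
    assume le: "u True i \<le> u False k"
    \<comment> \<open>For \<open>j \<ge> i\<close> monotonicity gives
      \<open>u True j \<le> u True i \<le> u False k\<close>, so only indices below \<open>i\<close>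
      are counted.\<close>
    have "card {j \<in> {1..N}. u False k < u True j} \<le> i - 1"
    proof (rule card_prefix_le)
      show "j < i" if "j \<in> {1..N}" "u False k < u True j" for j
        using anti[of i j True] that le i by (fastforce simp: not_less[symmetric])
    qed (use i in simp)
    moreover have "k \<le> card {j \<in> {1..N}. u True i < u False j \<or> u True i = u False j}"
    proof (rule card_prefix_ge)
      show "u True i < u False j \<or> u True i = u False j" if "1 \<le> j" "j \<le> k" for j
        using anti[of j k False] that le k by auto
    qed (use k in simp)
    ultimately show "merge_rank N u False k < k + i \<and> k + i \<le> merge_rank N u True i"
      using i by (auto simp: merge_rank_def)
  next
    assume less: "u False k < u True i"
    \<comment> \<open>Since \<open>less\<close> is strict, an index \<open>j \<ge> k\<close> cannot
      even tie with \<open>u True i\<close>.\<close>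
    have "card {j \<in> {1..N}. u True i < u False j \<or> u True i = u False j} \<le> k - 1"
    proof (rule card_prefix_le)
      show "j < k" if "j \<in> {1..N}" "u True i < u False j \<or> u True i = u False j" for j
        using anti[of k j False] that less k by (fastforce simp: not_less[symmetric])
    qed (use k in simp)
    moreover have "i \<le> card {j \<in> {1..N}. u False k < u True j}"
    proof (rule card_prefix_ge)
      show "u False k < u True j" if "1 \<le> j" "j \<le> i" for j
        using anti[of j i True] that less i by auto
    qed (use i in simp)
    ultimately show "merge_rank N u True i < k + i \<and> k + i \<le> merge_rank N u False k"
      using k by (auto simp: merge_rank_def)
  }
qed

text \<open>Within one sequence the indices decide; across the two, \<open>k + i\<close> lies
  between the ranks. This supplies the premise \<open>sorted\<close> of the rearrangement
  inequality.\<close>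

lemma merge_rank_sorted:
  assumes mono: "\<And>v. antimono_on {1..N} (u v)" and k: "k \<in> {1..N}" and i: "i \<in> {1..N}"
    and less: "u v k < u w i"
  shows "merge_rank N u w i \<le> merge_rank N u v k"
proof (cases "v = w")
  case True
  have "\<not> k \<le> i"
    using monotone_onD[OF mono k i] less True by (auto simp: not_less[symmetric])
  then show ?thesis
    using merge_rank_strict_mono[where u = u and v = w, OF mono i k] True by simp
next
  case False
  then consider "v" "\<not> w" | "\<not> v" "w"
    by auto
  then show ?thesis
  proof cases
    case 1
    then show ?thesis
      using less merge_rank_cross(1)[where u = u, OF mono i k] by simp
  next
    case 2
    then show ?thesis
      using less merge_rank_cross(2)[where u = u, OF mono k i] by simp
  qed
qed

text \<open>An odd \<open>s\<close> is the first member of a pair \<open>2 j - 1, 2 j\<close>, so a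
  cut just below \<open>s\<close> splits no pair.\<close>

lemma half_up_less:
  assumes "a < (s::nat)" "s \<le> b" "odd s"
  shows "(a + 1) div 2 < (b + 1) div 2"
  using assms by presburger

text \<open>For the zigzag set, the list of answer \<open>y\<close> contains exactly the atoms
  \<open>(k, odd k \<noteq> y)\<close>. Equal parity means the same sequence and ranks at least two
  apart. Different parity means different sequences, whose ranks are separated by the odd number
  \<open>k + i\<close>. Either way the ranks fall into different pairs.\<close>

lemma zigzag_time_inj:
  assumes mono: "\<And>v. antimono_on {1..N} (u v)"
  shows "inj_on (\<lambda>k. zigzag_time N u (odd k \<noteq> y) k) {1..N}"
proof (rule linorder_inj_onI')
  fix k i assume k: "k \<in> {1..N}" and i: "i \<in> {1..N}" and "k < i"
  show "zigzag_time N u (odd k \<noteq> y) k \<noteq> zigzag_time N u (odd i \<noteq> y) i"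
  proof (cases "odd k = odd i")
    case True
    then have "k + 2 \<le> i"
      using \<open>k < i\<close> by presburger
    moreover have "merge_rank N u (odd i \<noteq> y) k + (i - k) \<le> merge_rank N u (odd i \<noteq> y) i"
      using mono k i \<open>k < i\<close> by (rule merge_rank_strict_mono)
    ultimately have "merge_rank N u (odd i \<noteq> y) k + 2 \<le> merge_rank N u (odd i \<noteq> y) i"
      by linarith
    then show ?thesis
      using True unfolding zigzag_time_def by simp
  next
    case False
    have cross: "zigzag_time N u False a \<noteq> zigzag_time N u True b"
      if a: "a \<in> {1..N}" and b: "b \<in> {1..N}" and "odd (a + b)" for a b
    proof (cases "u True b \<le> u False a")
      case True
      then show ?thesis
        using merge_rank_cross(1)[where u = u, OF mono a b] \<open>odd (a + b)\<close>
          half_up_less[of "merge_rank N u False a" "a + b" "merge_rank N u True b"]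
        unfolding zigzag_time_def by simp
    next
      case False
      then show ?thesis
        using merge_rank_cross(2)[where u = u, OF mono a b] \<open>odd (a + b)\<close>
          half_up_less[of "merge_rank N u True b" "a + b" "merge_rank N u False a"]
        unfolding zigzag_time_def by simp
    qed
    show ?thesis
      using cross[OF k i] cross[OF i k] False by (cases "odd k \<noteq> y") auto
  qed
qed

lemma zigzag_time_range:
  assumes "k \<in> {1..N}"
  shows "zigzag_time N u v k \<in> {1..N}"
proof -
  have "card {i \<in> {1..N}. u v k < u (\<not> v) i \<or> (v \<and> u v k = u (\<not> v) i)} \<le> card {1..N}"
    by (intro card_mono) auto
  then have "1 \<le> merge_rank N u v k" "merge_rank N u v k \<le> 2 * N"
    using assms by (auto simp: merge_rank_def)
  then show ?thesis
    by (auto simp: zigzag_time_def)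
qed

section \<open>Strategies as assignments of times to atoms\<close>

lemma zigzag_strategy_exists:
  assumes mono: "\<And>v. antimono_on {1..N} (u v)"
  obtains \<sigma> where "\<sigma> \<in> guessing_strategies N"
    and "\<And>k v. k \<in> {1..N} \<Longrightarrow> inv (\<sigma> ((k \<in> zigzag_set N) \<noteq> v)) k = zigzag_time N u v k"
proof -
  \<comment> \<open>The times in list \<open>y\<close>, extended by the identity as
    \<open>permutes\<close> demands.\<close>
  define \<tau> where "\<tau> y k = (if k \<in> {1..N} then zigzag_time N u (odd k \<noteq> y) k else k)" for y k
  have "\<tau> y permutes {1..N}" for y
  proof (rule bij_imp_permutes)
    have "inj_on (\<tau> y) {1..N}"
      using zigzag_time_inj[where u = u and y = y, OF mono] by (rule inj_on_cong[THEN iffD1, rotated]) (simp add: \<tau>_def)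
    moreover have "\<tau> y ` {1..N} \<subseteq> {1..N}"
      using zigzag_time_range by (auto simp: \<tau>_def simp del: atLeastAtMost_iff)
    ultimately show "bij_betw (\<tau> y) {1..N} {1..N}"
      by (simp add: bij_betw_def endo_inj_surj)
  qed (auto simp: \<tau>_def)
  then have perm: "inv (\<tau> y) permutes {1..N}" "inv (inv (\<tau> y)) = \<tau> y" for y
    by (auto intro: permutes_inv permutes_inv_inv)
  show ?thesis
  \<comment> \<open>A strategy maps positions to guesses, so it is the inverse of the map to
    times.\<close>
  proof (rule that[of "\<lambda>y. inv (\<tau> y)"])
    show "(\<lambda>y. inv (\<tau> y)) \<in> guessing_strategies N"
      unfolding guessing_strategies_def using perm(1) by blast
    show "inv (inv (\<tau> ((k \<in> zigzag_set N) \<noteq> v))) k = zigzag_time N u v k" if "k \<in> {1..N}" for k v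
    proof -
      have "(odd k \<noteq> ((k \<in> zigzag_set N) \<noteq> v)) = v"
        using that by (auto simp: zigzag_set_def)
      then show ?thesis
        using that by (simp add: perm \<tau>_def)
    qed
  qed
qed

text \<open>For fixed \<open>k\<close>, the two values of \<open>v\<close> lead to the two different
  lists, whatever \<open>A\<close> is. So each time is used once per list; threshold functions
  \<open>h\<close> yield the premise \<open>count\<close>.\<close>

lemma sum_over_guessing_times:
  fixes h :: "nat \<Rightarrow> real"
  assumes "\<sigma> \<in> guessing_strategies N"
  shows "(\<Sum>(k, v)\<in>{1..N} \<times> UNIV. h (inv (\<sigma> ((k \<in> A) \<noteq> v)) k)) = 2 * (\<Sum>t\<in>{1..N}. h t)"
proof -
  have perm: "inv (\<sigma> y) permutes {1..N}" for y
    using assms by (auto simp: guessing_strategies_def intro: permutes_inv)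
  have "(\<Sum>(k, v)\<in>{1..N} \<times> UNIV. h (inv (\<sigma> ((k \<in> A) \<noteq> v)) k))
      = (\<Sum>k\<in>{1..N}. \<Sum>v\<in>UNIV. h (inv (\<sigma> ((k \<in> A) \<noteq> v)) k))"
    by (simp add: sum.cartesian_product)
  also have "\<dots> = (\<Sum>k\<in>{1..N}. h (inv (\<sigma> True) k) + h (inv (\<sigma> False) k))"
  proof (rule sum.cong)
    show "(\<Sum>v\<in>UNIV. h (inv (\<sigma> ((k \<in> A) \<noteq> v)) k)) = h (inv (\<sigma> True) k) + h (inv (\<sigma> False) k)" for k
      by (cases "k \<in> A") (simp_all add: UNIV_bool)
  qed simp
  also have "\<dots> = 2 * (\<Sum>t\<in>{1..N}. h t)"
    using sum.permute[OF perm[of True], of h] sum.permute[OF perm[of False], of h]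
    by (simp add: sum.distrib o_def)
  finally show ?thesis .
qed

section \<open>The joint law of \<open>X\<close> and \<open>V\<close>\<close>

lemma prob_bernoulli_eq:
  assumes "prob_space M" "V \<in> measurable M (count_space UNIV)" "\<epsilon> \<in> {0..1}"
    and "distr M (count_space UNIV) V = measure_pmf (bernoulli_pmf \<epsilon>)"
  shows "measure M {\<omega> \<in> space M. V \<omega> = v} = (if v then \<epsilon> else 1 - \<epsilon>)"
proof -
  have "measure M {\<omega> \<in> space M. V \<omega> = v} = measure (distr M (count_space UNIV) V) {v}"
    using assms(2) by (subst measure_distr) (auto intro!: arg_cong[where f = "measure M"])
  also have "\<dots> = pmf (bernoulli_pmf \<epsilon>) v"
    by (simp add: assms(4) measure_pmf_single)
  finally show ?thesis
    using assms(3) by (cases v) auto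
qed

lemma prob_independent_rvs:
  assumes "prob_space M" and ind: "independent_rvs M (count_space S) X (count_space T) Y"
    and "x \<in> S" "y \<in> T"
  shows "measure M {\<omega> \<in> space M. X \<omega> = x \<and> Y \<omega> = y}
    = measure M {\<omega> \<in> space M. X \<omega> = x} * measure M {\<omega> \<in> space M. Y \<omega> = y}"
proof -
  interpret prob_space M by fact
  have "{\<omega> \<in> space M. X \<omega> = x} = X -` {x} \<inter> space M"
    by auto
  then have x: "{\<omega> \<in> space M. X \<omega> = x} \<in> sets (vimage_algebra (space M) X (count_space S))"
    using \<open>x \<in> S\<close> by (simp add: in_vimage_algebra)
  have "{\<omega> \<in> space M. Y \<omega> = y} = Y -` {y} \<inter> space M"
    by auto
  then have y: "{\<omega> \<in> space M. Y \<omega> = y} \<in> sets (vimage_algebra (space M) Y (count_space T))"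
    using \<open>y \<in> T\<close> by (simp add: in_vimage_algebra)
  have "indep_set (sets (vimage_algebra (space M) X (count_space S)))
      (sets (vimage_algebra (space M) Y (count_space T)))"
    using ind by (simp add: independent_rvs_def)
  from indep_setD[OF this x y] show ?thesis
    by (simp add: Int_def conj_ac)
qed

lemma (in prob_space) expectation_finite_pair:
  fixes g :: "'b \<Rightarrow> 'c \<Rightarrow> real"
  assumes [measurable]: "X \<in> measurable M (count_space S)" "Y \<in> measurable M (count_space T)"
    and "finite S" "finite T"
  shows "expectation (\<lambda>\<omega>. g (X \<omega>) (Y \<omega>))
    = (\<Sum>(x, y)\<in>S \<times> T. prob {\<omega> \<in> space M. X \<omega> = x \<and> Y \<omega> = y} * g x y)"
proof -
  define E where "E x y = {\<omega> \<in> space M. X \<omega> = x \<and> Y \<omega> = y}" for x y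
  have E: "E x y \<in> events" if "x \<in> S" "y \<in> T" for x y
  proof -
    have "E x y = (X -` {x} \<inter> space M) \<inter> (Y -` {y} \<inter> space M)"
      by (auto simp: E_def)
    moreover have "X -` {x} \<inter> space M \<in> events" "Y -` {y} \<inter> space M \<in> events"
      using that by (auto intro!: measurable_sets[OF assms(1)] measurable_sets[OF assms(2)])
    ultimately show ?thesis
      by auto
  qed
  have "expectation (\<lambda>\<omega>. g (X \<omega>) (Y \<omega>))
      = expectation (\<lambda>\<omega>. \<Sum>(x, y)\<in>S \<times> T. g x y * indicator (E x y) \<omega>)"
  proof (intro Bochner_Integration.integral_cong refl)
    fix \<omega> assume \<omega>: "\<omega> \<in> space M"
    then have "(X \<omega>, Y \<omega>) \<in> S \<times> T"
      using measurable_space[OF assms(1)] measurable_space[OF assms(2)] by auto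
    \<comment> \<open>The events \<open>E x y\<close> partition the space, so only the pair of
      actual values survives.\<close>
    then have "(\<Sum>(x, y)\<in>S \<times> T. g x y * indicator (E x y) \<omega>)
        = (\<Sum>(x, y)\<in>{(X \<omega>, Y \<omega>)}. g x y * indicator (E x y) \<omega>)"
      using \<open>finite S\<close> \<open>finite T\<close>
      by (intro sum.mono_neutral_right) (auto simp: E_def indicator_def)
    then show "g (X \<omega>) (Y \<omega>) = (\<Sum>(x, y)\<in>S \<times> T. g x y * indicator (E x y) \<omega>)"
      using \<omega> by (simp add: E_def)
  qed
  also have "\<dots> = (\<Sum>(x, y)\<in>S \<times> T. g x y * prob (E x y))"
    using E by (subst Bochner_Integration.integral_sum)
      (auto intro!: sum.cong simp: emeasure_eq_measure Int_absorb2 sets.sets_into_space split_beta)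
  finally show ?thesis
    by (simp add: E_def mult.commute)
qed

section \<open>Optimality of the zigzag set\<close>

theorem theorem2:
  fixes M :: "'a measure" and N :: nat and X :: "'a \<Rightarrow> nat" and V :: "'a \<Rightarrow> bool"
    and p :: "nat \<Rightarrow> real" and \<epsilon> :: real and f :: "nat \<Rightarrow> real"
  assumes "prob_space M"
    and "N \<ge> 1"
    and "X \<in> measurable M (count_space {1..N})"
    and "\<And>k. k \<in> {1..N} \<Longrightarrow> measure M {\<omega> \<in> space M. X \<omega> = k} = p k"
    and "antimono_on {1..N} p"
    and "\<epsilon> \<in> {0..1}"
    and "V \<in> measurable M (count_space UNIV)"
    and "distr M (count_space UNIV) V = measure_pmf (bernoulli_pmf \<epsilon>)"
    and "independent_rvs M (count_space {1..N}) X (count_space UNIV) V"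
    and "mono_on {1..N} f"
  shows "min_guessing_cost M N f X V (zigzag_set N) =
         Min (min_guessing_cost M N f X V ` Pow {1..N})"
proof -
  interpret prob_space M by fact
  \<comment> \<open>The probability of the atom \<open>(k, v)\<close>; both sequences are
    nonnegative multiples of \<open>p\<close> and hence decreasing.\<close>
  define u where "u v k = (if v then \<epsilon> else 1 - \<epsilon>) * p k" for v k
  define cost where
    "cost A \<sigma> = expectation (\<lambda>\<omega>. f (guessing_time \<sigma> X (noisy_answer X V A) \<omega>))" for A \<sigma>
  define time :: "nat set \<Rightarrow> (bool \<Rightarrow> nat \<Rightarrow> nat) \<Rightarrow> nat \<times> bool \<Rightarrow> nat"
    where "time A \<sigma> = (\<lambda>(k, v). inv (\<sigma> ((k \<in> A) \<noteq> v)) k)" for A \<sigma>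
  let ?I = "{1..N} \<times> (UNIV :: bool set)" and ?W = "\<lambda>(k, v). u v k"
  have prob: "prob {\<omega> \<in> space M. X \<omega> = k \<and> V \<omega> = v} = u v k" if "k \<in> {1..N}" for k v
    using prob_independent_rvs[OF assms(1,9) that UNIV_I, of v] assms(4)[OF that]
      prob_bernoulli_eq[OF assms(1,7,6,8), of v] by (simp add: u_def)
  have cost: "cost A \<sigma> = (\<Sum>x\<in>?I. ?W x * f (time A \<sigma> x))" for A \<sigma>
    using expectation_finite_pair[OF assms(3,7), of "\<lambda>k v. f (time A \<sigma> (k, v))"]
    by (auto simp: cost_def guessing_time_def noisy_answer_def time_def prob intro!: sum.cong)
  have time: "time A \<sigma> \<in> ?I \<rightarrow> {1..N}" if "\<sigma> \<in> guessing_strategies N" for A \<sigma>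
  proof -
    have "inv (\<sigma> y) k \<in> {1..N}" if "k \<in> {1..N}" for y k
      using \<open>\<sigma> \<in> guessing_strategies N\<close> that
      by (simp add: guessing_strategies_def permutes_inv permutes_in_image del: atLeastAtMost_iff)
    then show ?thesis
      by (auto simp: time_def simp del: atLeastAtMost_iff)
  qed
  have mono: "antimono_on {1..N} (u v)" for v
    using monotone_onD[OF assms(5)] assms(6)
    by (auto intro!: monotone_onI mult_left_mono simp: u_def)
  obtain \<sigma>\<^sub>0 where \<sigma>\<^sub>0: "\<sigma>\<^sub>0 \<in> guessing_strategies N"
    and zigzag: "\<And>k v. k \<in> {1..N} \<Longrightarrow>
      inv (\<sigma>\<^sub>0 ((k \<in> zigzag_set N) \<noteq> v)) k = zigzag_time N u v k"
    using zigzag_strategy_exists[of N u, OF mono] by blast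
  \<comment> \<open>One strategy for the zigzag set beats or equals every strategy for every
    \<open>A\<close>, because only the assignment of times to the common atoms changes.\<close>
  have optimal: "cost (zigzag_set N) \<sigma>\<^sub>0 \<le> cost A \<sigma>" if \<sigma>: "\<sigma> \<in> guessing_strategies N" for A \<sigma>
    unfolding cost
  proof (rule rearrangement_le)
    show "(\<Sum>x\<in>?I. of_bool (j < time (zigzag_set N) \<sigma>\<^sub>0 x))
        = (\<Sum>x\<in>?I. of_bool (j < time A \<sigma> x) :: real)" for j
      using sum_over_guessing_times[OF \<sigma>\<^sub>0, of "\<lambda>t. of_bool (j < t)" "zigzag_set N"]
        sum_over_guessing_times[OF \<sigma>, of "\<lambda>t. of_bool (j < t)" A]
      by (simp add: time_def split_beta)
    show "time (zigzag_set N) \<sigma>\<^sub>0 y \<le> time (zigzag_set N) \<sigma>\<^sub>0 x"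
      if "x \<in> ?I" "y \<in> ?I" "?W x < ?W y" for x y
    proof -
      obtain k v i w where xy: "x = (k, v)" "y = (i, w)"
        by (metis surj_pair)
      then have "merge_rank N u w i \<le> merge_rank N u v k"
        using that by (intro merge_rank_sorted[OF mono]) auto
      then show ?thesis
        using that xy zigzag by (simp add: time_def zigzag_time_def div_le_mono)
    qed
  qed (use time \<sigma>\<^sub>0 \<sigma> assms(10) in auto)
  have G: "min_guessing_cost M N f X V A = Min (cost A ` guessing_strategies N)" for A
    by (simp add: min_guessing_cost_def cost_def)
  have "min_guessing_cost M N f X V (zigzag_set N) \<le> min_guessing_cost M N f X V A" for A
  proof -
    have "min_guessing_cost M N f X V (zigzag_set N) \<le> cost (zigzag_set N) \<sigma>\<^sub>0"
      unfolding G using \<sigma>\<^sub>0 finite_guessing_strategies by (intro Min_le) auto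
    also have "\<dots> \<le> min_guessing_cost M N f X V A"
      unfolding G using optimal finite_guessing_strategies guessing_strategies_nonempty
      by (intro Min.boundedI) auto
    finally show ?thesis .
  qed
  moreover have "zigzag_set N \<in> Pow {1..N}"
    by (auto simp: zigzag_set_def)
  \<comment> \<open>The zigzag set is itself a competitor, so the lower bound is attained.\<close>
  ultimately show ?thesis
    by (intro Min_eqI[symmetric]) auto
qed

end
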